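(* Let $G$ be a graph with a bipartition $(A,B)$, such that every vertex in $B$ has a neighbour in $A$; and let $\Gamma,\Delta,d>0$ be real numbers with $d<1$, such that every vertex in $A$ has at most $\Delta$ neighbours in $B$. Then either: \begin{itemize} \item for some integer $t\ge 1$, there is a $(t,\Gamma t^{-1/d})$-comb in $(A,B)$; or \item $|B|\le \dfrac{3^{d+1}}{3/2-(3/2)^{d}}\,\Gamma^d\Delta^{1-d}$. \end{itemize}
   Context: All graphs are finite, with no loops or parallel edges. Let $G$ be a graph and let $t,k\ge 0$ where $t$ is an integer ($k$ is real). A $(t,k)$-comb in $G$ is a family $((a_i,B_i): 1\le i\le t)$ such that: $a_1,\ldots,a_t\in V(G)$ are distinct, and $B_1,\ldots,B_t$ are pairwise disjoint subsets of $V(G)\setminus\{a_1,\ldots,a_t\}$; for $1\le i\le t$, $a_i$ is adjacent to every vertex in $B_i$; for distinct $i,j\in\{1,\ldots,t\}$, $a_i$ has no neighbour in $B_j$; and $B_1,\ldots,B_t$ all have cardinality at least $k$. If $A,B\subseteq V(G)$ are disjoint, $a_1,\ldots,a_t\in A$ and $B_1,\ldots,B_t\subseteq B$, this is called a $(t,k)$-comb in $(A,B)$. *)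

theory Defs
  imports Complex_Main "HOL-Library.Disjoint_Sets" "Graph_Theory.Digraph"
begin

text \<open>
  Finite graphs without loops or parallel edges are modelled by the locale predicate
  \<^const>\<open>graph\<close> (finite symmetric digraphs without loops or parallel arcs): an undirected edge is
  a pair of opposite arcs, and adjacency is \<^const>\<open>dominates\<close>.
\<close>

definition bipartition :: "('v, 'e) pre_digraph \<Rightarrow> 'v set \<Rightarrow> 'v set \<Rightarrow> bool" where
  "bipartition G A B \<longleftrightarrow>
     A \<union> B = verts G \<and> A \<inter> B = {} \<and>
     (\<forall>u\<in>A. \<forall>v\<in>A. \<not> u \<rightarrow>\<^bsub>G\<^esub> v) \<and>
     (\<forall>u\<in>B. \<forall>v\<in>B. \<not> u \<rightarrow>\<^bsub>G\<^esub> v)"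

definition neighbours_in :: "('v, 'e) pre_digraph \<Rightarrow> 'v \<Rightarrow> 'v set \<Rightarrow> 'v set" where
  "neighbours_in G v X = {w \<in> X. v \<rightarrow>\<^bsub>G\<^esub> w}"

text \<open>Only the values of the two families at the indices in \<open>{1..t}\<close> matter.\<close>

definition comb ::
  "('v, 'e) pre_digraph \<Rightarrow> nat \<Rightarrow> real \<Rightarrow> (nat \<Rightarrow> 'v) \<Rightarrow> (nat \<Rightarrow> 'v set) \<Rightarrow> bool" where
  "comb G t k a B \<longleftrightarrow>
     a ` {1..t} \<subseteq> verts G \<and> inj_on a {1..t} \<and>
     (\<forall>i\<in>{1..t}. B i \<subseteq> verts G - a ` {1..t}) \<and>
     disjoint_family_on B {1..t} \<and>
     (\<forall>i\<in>{1..t}. \<forall>v\<in>B i. a i \<rightarrow>\<^bsub>G\<^esub> v) \<and>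
     (\<forall>i\<in>{1..t}. \<forall>j\<in>{1..t}. i \<noteq> j \<longrightarrow> neighbours_in G (a i) (B j) = {}) \<and>
     (\<forall>i\<in>{1..t}. k \<le> real (card (B i)))"

definition comb_in ::
  "('v, 'e) pre_digraph \<Rightarrow> 'v set \<Rightarrow> 'v set \<Rightarrow> nat \<Rightarrow> real \<Rightarrow> (nat \<Rightarrow> 'v) \<Rightarrow> (nat \<Rightarrow> 'v set) \<Rightarrow> bool"
  where
  "comb_in G X Y t k a B \<longleftrightarrow>
     X \<subseteq> verts G \<and> Y \<subseteq> verts G \<and> X \<inter> Y = {} \<and>
     comb G t k a B \<and> a ` {1..t} \<subseteq> X \<and> (\<forall>i\<in>{1..t}. B i \<subseteq> Y)"

end

theory Submission
  imports Defs
begin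

text \<open>
  Suppose that all vertices of \<open>A\<close> have degree at most \<open>D\<close> into \<open>B\<close>. Remove neighbourhoods
  \<open>C\<^sub>1, C\<^sub>2, \<dots>\<close> of vertices \<open>a\<^sub>1, a\<^sub>2, \<dots>\<close> of \<open>A\<close> one after the other, each of size more than
  \<open>2D/3\<close> at the time of its removal, until all degrees are at most \<open>2D/3\<close>. Go through the
  \<open>a\<^sub>i\<close> backwards and select \<open>a\<^sub>i\<close> iff the already selected vertices send at most \<open>D/3\<close> edges in
  total to \<open>C\<^sub>i\<close>. The selected vertices are the heads of a comb with teeth of size at least
  \<open>D/3\<close>, and since each of them sends at most \<open>D/3\<close> edges to the earlier \<open>C\<^sub>i\<close>, at least half of
  the \<open>a\<^sub>i\<close> are selected. So if there is no comb then at most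
  \<open>2 \<cdot> 3\<^sup>d \<Gamma>\<^sup>d D\<^bsup>1 - d\<^esup>\<close> vertices have been removed; iterating with \<open>D\<close> replaced by \<open>2D/3\<close> gives a
  geometric series.
\<close>

section \<open>Greedy extraction of one comb\<close>

text \<open>Combs are indexed by the set \<open>S\<close> of heads itself, so that adding a head is
  just \<open>insert\<close>; \<open>N\<close> stands for an arbitrary neighbourhood map, and heads
  and teeth may live in different types.\<close>

definition set_comb :: "('a \<Rightarrow> 'b set) \<Rightarrow> real \<Rightarrow> 'a set \<Rightarrow> ('a \<Rightarrow> 'b set) \<Rightarrow> bool" where
  "set_comb N k S T \<longleftrightarrow>
     disjoint_family_on T S \<and> (\<forall>s\<in>S. T s \<subseteq> N s \<and> k \<le> real (card (T s))) \<and>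
     (\<forall>s\<in>S. \<forall>s'\<in>S. s \<noteq> s' \<longrightarrow> N s \<inter> T s' = {})"

text \<open>
  The last conjunct is the induction invariant that amounts to the selection of at least half of
  the vertices: selecting \<open>a\<close> with neighbourhood \<open>C\<close> adds \<open>(card C + D) / 3 \<le> card C\<close> to the left
  side and at least \<open>card C\<close> to the right side; rejecting \<open>a\<close> adds \<open>card C / 3 \<le> D / 3\<close> to the
  left side and more than \<open>D / 3\<close> to the right side.
\<close>

lemma greedy_comb_invariant:
  fixes N :: "'a \<Rightarrow> 'b set" and D :: real
  assumes "finite B" "D > 0" "\<And>a. a \<in> A \<Longrightarrow> real (card (N a \<inter> B)) \<le> D"
  shows "\<exists>S T U. finite S \<and> S \<subseteq> A \<and> U \<subseteq> B \<and> (\<forall>s\<in>S. T s \<subseteq> U) \<and> set_comb N (D / 3) S T \<and>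
           (\<forall>a\<in>A. real (card (N a \<inter> (B - U))) \<le> 2 * D / 3) \<and>
           real (card U) / 3 + real (card S) * D / 3 \<le> (\<Sum>s\<in>S. real (card (N s \<inter> U)))"
  using assms(1,3)
proof (induction B rule: finite_psubset_induct)
  case (psubset B)
  show ?case
  proof (cases "\<forall>a\<in>A. real (card (N a \<inter> B)) \<le> 2 * D / 3")
    case True
    then show ?thesis
      by (intro exI[of _ "{}"] exI[of _ "\<lambda>_. {}"]) (auto simp: set_comb_def disjoint_family_on_def)
  next
    case False
    then obtain a where a: "a \<in> A" "real (card (N a \<inter> B)) > 2 * D / 3" by force
    define C where "C = N a \<inter> B"
    have C: "C \<subseteq> B" "finite C" "real (card C) > 2 * D / 3" "real (card C) \<le> D"
      using a psubset.prems[of a] psubset.hyps by (auto simp: C_def)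
    have "C \<noteq> {}" using C(3) \<open>D > 0\<close> by auto
    then have "B - C \<subset> B" using C(1) by auto
    moreover have "real (card (N x \<inter> (B - C))) \<le> D" if "x \<in> A" for x
    proof -
      have "card (N x \<inter> (B - C)) \<le> card (N x \<inter> B)"
        by (intro card_mono) (use psubset.hyps in auto)
      then show ?thesis using psubset.prems[OF that] by linarith
    qed
    \<comment> \<open>The induction hypothesis settles the vertices picked after \<open>a\<close>
      first, so deciding on \<open>a\<close> only now realises the backward pass.\<close>
    ultimately obtain S T U where S: "finite S" "S \<subseteq> A" and U: "U \<subseteq> B - C"
      and TU: "\<forall>s\<in>S. T s \<subseteq> U" and comb: "set_comb N (D / 3) S T"
      and deg: "\<forall>a\<in>A. real (card (N a \<inter> (B - C - U))) \<le> 2 * D / 3"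
      and inv: "real (card U) / 3 + real (card S) * D / 3 \<le> (\<Sum>s\<in>S. real (card (N s \<inter> U)))"
      using psubset.IH[of "B - C"] by blast
    have finU: "finite U" using U psubset.hyps by (auto intro: finite_subset)
    have cardU: "real (card (U \<union> C)) = real (card U) + real (card C)"
      using U finU C(2) by (subst card_Un_disjoint) auto
    have cardN: "real (card (N s \<inter> (U \<union> C))) = real (card (N s \<inter> U)) + real (card (N s \<inter> C))" for s
    proof -
      have "N s \<inter> (U \<union> C) = (N s \<inter> U) \<union> (N s \<inter> C)" by auto
      then show ?thesis using U finU C(2) by (simp, subst card_Un_disjoint) auto
    qed
    define x where "x = (\<Sum>s\<in>S. real (card (N s \<inter> C)))"
    have deg': "\<forall>a\<in>A. real (card (N a \<inter> (B - (U \<union> C)))) \<le> 2 * D / 3"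
    proof -
      have "B - (U \<union> C) = B - C - U" by auto
      then show ?thesis using deg by simp
    qed
    have sumN: "(\<Sum>s\<in>S. real (card (N s \<inter> (U \<union> C)))) = (\<Sum>s\<in>S. real (card (N s \<inter> U))) + x"
      by (simp add: cardN sum.distrib x_def)
    show ?thesis
    proof (cases "x \<le> D / 3")
      case False
      have "real (card (U \<union> C)) / 3 + real (card S) * D / 3
          \<le> (\<Sum>s\<in>S. real (card (N s \<inter> (U \<union> C))))"
        using inv False C(4) unfolding sumN cardU by argo
      then show ?thesis
        using S U C(1) TU comb deg' by (intro exI[of _ S] exI[of _ T] exI[of _ "U \<union> C"]) auto
    next
      case True
      \<comment> \<open>All neighbours of \<open>a\<close> in \<open>B\<close> lie in
        \<open>C\<close>, whereas the old teeth avoid \<open>C\<close>. Only edges from old heads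
        into \<open>C\<close> can obstruct selecting \<open>a\<close>.\<close>
      have NT: "N a \<inter> T s = {}" if "s \<in> S" for s
        using TU U that by (auto simp: C_def)
      have "a \<notin> S"
      proof
        assume "a \<in> S"
        then have "T a = {}" "real (card (T a)) \<ge> D / 3"
          using NT[of a] comb by (auto simp: set_comb_def)
        then show False using \<open>D > 0\<close> by simp
      qed
      \<comment> \<open>The part of \<open>C\<close> seen by old heads is cut off from the new
        tooth. It has at most \<open>x \<le> D / 3\<close> elements, which leaves more than
        \<open>2 * D / 3 - D / 3\<close>.\<close>
      define W where "W = C \<inter> (\<Union>s\<in>S. N s)"
      have "card W \<le> (\<Sum>s\<in>S. card (N s \<inter> C))"
      proof -
        have "W = (\<Union>s\<in>S. N s \<inter> C)" by (auto simp: W_def)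
        then show ?thesis using card_UN_le[OF S(1)] by metis
      qed
      then have W: "real (card W) \<le> x" unfolding x_def of_nat_sum[symmetric] by linarith
      have "real (card (C - W)) = real (card C) - real (card W)"
        using C(2) by (subst card_Diff_subset) (auto simp: W_def intro!: of_nat_diff card_mono)
      then have tooth: "real (card (C - W)) \<ge> D / 3" using W True C(3) by argo
      define T' where "T' = T(a := C - W)"
      have T': "T' a = C - W" "\<And>s. s \<in> S \<Longrightarrow> T' s = T s"
        using \<open>a \<notin> S\<close> by (auto simp: T'_def)
      have disj: "disjoint_family_on T' (insert a S)"
        using \<open>a \<notin> S\<close> comb TU U T'
        by (subst disjoint_family_on_insert)
           (auto simp: set_comb_def disjoint_family_on_def)
      have comb': "set_comb N (D / 3) (insert a S) T'"
        unfolding set_comb_def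
      proof (intro conjI disj ballI impI)
        fix s assume "s \<in> insert a S"
        then show "T' s \<subseteq> N s" "D / 3 \<le> real (card (T' s))"
          using comb tooth T' by (fastforce simp: set_comb_def C_def)+
      next
        fix s s' assume "s \<in> insert a S" "s' \<in> insert a S" "s \<noteq> s'"
        then consider "s' = a" "s \<in> S" | "s = a" "s' \<in> S" | "s \<in> S" "s' \<in> S" by blast
        then show "N s \<inter> T' s' = {}"
        proof cases
          case 1
          then show ?thesis using T'(1) by (auto simp: W_def)
        next
          case 2
          then show ?thesis using T'(2) NT by simp
        next
          case 3
          then show ?thesis using T'(2) comb \<open>s \<noteq> s'\<close> by (simp add: set_comb_def)
        qed
      qed
      have "N a \<inter> (U \<union> C) = C" using U by (auto simp: C_def)
      then have "(\<Sum>s\<in>insert a S. real (card (N s \<inter> (U \<union> C))))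
          = real (card C) + (\<Sum>s\<in>S. real (card (N s \<inter> U))) + x"
        using S(1) \<open>a \<notin> S\<close> sumN by simp
      moreover have "x \<ge> 0" by (simp add: x_def sum_nonneg)
      moreover have "real (card (insert a S)) * D = real (card S) * D + D"
        using S(1) \<open>a \<notin> S\<close> by (simp add: algebra_simps)
      ultimately have "real (card (U \<union> C)) / 3 + real (card (insert a S)) * D / 3
          \<le> (\<Sum>s\<in>insert a S. real (card (N s \<inter> (U \<union> C))))"
        using inv C(3) \<open>D > 0\<close> unfolding cardU by argo
      moreover have "\<forall>s\<in>insert a S. T' s \<subseteq> U \<union> C" using TU T' by auto
      ultimately show ?thesis
        using S a(1) U C(1) comb' deg'
        by (intro exI[of _ "insert a S"] exI[of _ T'] exI[of _ "U \<union> C"]) auto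
    qed
  qed
qed

text \<open>Each selected head has at most \<open>D\<close> neighbours in \<open>U\<close>, so the
  right side of the invariant is at most \<open>card S * D\<close>; solving for
  \<open>card U\<close> gives the factor 2.\<close>

lemma greedy_comb:
  fixes N :: "'a \<Rightarrow> 'b set" and D :: real
  assumes "finite B" "D > 0" and deg: "\<And>a. a \<in> A \<Longrightarrow> real (card (N a \<inter> B)) \<le> D"
  shows "\<exists>S T U. finite S \<and> S \<subseteq> A \<and> U \<subseteq> B \<and> (\<forall>s\<in>S. T s \<subseteq> U) \<and> set_comb N (D / 3) S T \<and>
           (\<forall>a\<in>A. real (card (N a \<inter> (B - U))) \<le> 2 * D / 3) \<and>
           real (card U) \<le> 2 * real (card S) * D"
proof -
  obtain S T U where S: "finite S" "S \<subseteq> A" "U \<subseteq> B" "\<forall>s\<in>S. T s \<subseteq> U" "set_comb N (D / 3) S T"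
      "\<forall>a\<in>A. real (card (N a \<inter> (B - U))) \<le> 2 * D / 3"
      and inv: "real (card U) / 3 + real (card S) * D / 3 \<le> (\<Sum>s\<in>S. real (card (N s \<inter> U)))"
    using greedy_comb_invariant[of B D A N] assms by blast
  have "(\<Sum>s\<in>S. real (card (N s \<inter> U))) \<le> (\<Sum>s\<in>S. D)"
  proof (rule sum_mono)
    fix s assume "s \<in> S"
    have "card (N s \<inter> U) \<le> card (N s \<inter> B)"
      using S(3) \<open>finite B\<close> by (intro card_mono) auto
    then show "real (card (N s \<inter> U)) \<le> D" using deg[of s] S(2) \<open>s \<in> S\<close> by fastforce
  qed
  then have "real (card U) \<le> 2 * real (card S) * D" using inv by simp
  then show ?thesis using S by blast
qed

section \<open>Iteration and the geometric series\<close>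

lemma set_comb_mono: "set_comb N k S T \<Longrightarrow> k' \<le> k \<Longrightarrow> set_comb N k' S T"
  by (force simp: set_comb_def)

lemma card_le_geometric_if_no_comb:
  fixes N :: "'a \<Rightarrow> 'b set" and \<Gamma> \<Delta> d :: real
  assumes "\<Gamma> > 0" "0 < d" "d < 1" "finite B" "\<Delta> > 0"
    and "\<And>a. a \<in> A \<Longrightarrow> real (card (N a \<inter> B)) \<le> \<Delta>"
    and "B \<subseteq> (\<Union>a\<in>A. N a)"
    and no_comb: "\<not> (\<exists>S T. finite S \<and> S \<noteq> {} \<and> S \<subseteq> A \<and> (\<forall>s\<in>S. T s \<subseteq> B) \<and>
      set_comb N (\<Gamma> * real (card S) powr (- 1 / d)) S T)"
  shows "real (card B) \<le> 2 * (3 * \<Gamma>) powr d * \<Delta> powr (1 - d) / (1 - (2/3) powr (1 - d))"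
proof -
  define q :: real where "q = (2/3) powr (1 - d)"
  define K where "K = 2 * (3 * \<Gamma>) powr d"
  have q: "0 < q" "q < 1" 
    using \<open>d < 1\<close> powr_less_mono2[of "1 - d" "2/3" 1] by (auto simp: q_def)
  have "K > 0" using \<open>\<Gamma> > 0\<close> by (simp add: K_def)
  \<comment> \<open>Here \<open>n\<close> bounds the number of rounds still to run: each multiplies
    the degree bound by 2/3. Once the bound is below 1, all degrees are 0, and the covering
    hypothesis forces \<open>B'\<close> to be empty.\<close>
  have claim: "real (card B') \<le> K * D powr (1 - d) / (1 - q)"
    if "B' \<subseteq> B" "D > 0" "\<And>a. a \<in> A \<Longrightarrow> real (card (N a \<inter> B')) \<le> D" "(2/3) ^ n * D < 1" for n B' D
    using that
  proof (induction n arbitrary: B' D)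
    case 0
    have "B' = {}"
    proof (rule ccontr)
      assume "B' \<noteq> {}"
      then obtain b a where "b \<in> B'" "a \<in> A" "b \<in> N a" using 0(1) assms(7) by blast
      moreover have "finite (N a \<inter> B')" using 0(1) \<open>finite B\<close> by (auto intro: finite_subset)
      ultimately have "card (N a \<inter> B') \<noteq> 0" by (subst card_0_eq) auto
      then show False using 0(3)[OF \<open>a \<in> A\<close>] 0(4) by simp
    qed
    then show ?case using q \<open>K > 0\<close> by simp
  next
    case (Suc n)
    have "finite B'" using Suc.prems(1) \<open>finite B\<close> by (rule finite_subset)
    obtain S T U where S: "finite S" "S \<subseteq> A" and U: "U \<subseteq> B'"
      and TU: "\<forall>s\<in>S. T s \<subseteq> U" and comb: "set_comb N (D / 3) S T"
      and deg: "\<forall>a\<in>A. real (card (N a \<inter> (B' - U))) \<le> 2 * D / 3"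
      and cardU: "real (card U) \<le> 2 * real (card S) * D"
      using greedy_comb[where N = N, OF \<open>finite B'\<close> Suc.prems(2,3)] by metis
    \<comment> \<open>The teeth have size at least \<open>D / 3\<close>, so the absence of a comb
      means \<open>D / 3 < \<Gamma> * s powr (- 1 / d)\<close>; this is solved for
      \<open>s\<close>.\<close>
    have "real (card S) \<le> (3 * \<Gamma> / D) powr d"
    proof (cases "S = {}")
      case False
      define s where "s = real (card S)"
      have "s > 0" using False S(1) by (simp add: s_def card_gt_0_iff)
      have "\<forall>x\<in>S. T x \<subseteq> B" using TU U Suc.prems(1) by blast
      then have "\<not> set_comb N (\<Gamma> * s powr (- 1 / d)) S T"
        using no_comb S False unfolding s_def by blast
      then have "D / 3 < \<Gamma> * s powr (- 1 / d)" using set_comb_mono[OF comb] by force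
      then have "s powr (1 / d) < 3 * \<Gamma> / D"
        using \<open>s > 0\<close> \<open>D > 0\<close> by (simp add: powr_minus field_simps)
      then have "(s powr (1 / d)) powr d \<le> (3 * \<Gamma> / D) powr d"
        using \<open>0 < d\<close> by (intro powr_mono2) auto
      then show ?thesis using \<open>0 < d\<close> \<open>s > 0\<close> by (simp add: powr_powr s_def)
    qed simp
    then have "2 * real (card S) * D \<le> 2 * (3 * \<Gamma> / D) powr d * D"
      using \<open>D > 0\<close> by simp
    also have "\<dots> = K * D powr (1 - d)"
      using \<open>D > 0\<close> \<open>\<Gamma> > 0\<close> by (simp add: K_def powr_divide powr_diff)
    finally have "real (card U) \<le> K * D powr (1 - d)" using cardU by linarith
    moreover have "real (card (B' - U)) \<le> K * (2 * D / 3) powr (1 - d) / (1 - q)"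
      using Suc.prems U deg by (intro Suc.IH) (auto simp: field_simps)
    moreover have "(2 * D / 3) powr (1 - d) = q * D powr (1 - d)"
    proof -
      have "2 * D / 3 = 2 / 3 * D" by simp
      then show ?thesis unfolding q_def using \<open>D > 0\<close> by (simp only: powr_mult)
    qed
    moreover have "real (card B') = real (card U) + real (card (B' - U))"
      using card_Diff_subset[of U B'] card_mono[OF \<open>finite B'\<close> U] U \<open>finite B'\<close>
      by (simp add: finite_subset)
    ultimately have "real (card B')
        \<le> K * D powr (1 - d) + K * (q * D powr (1 - d)) / (1 - q)" by simp
    \<comment> \<open>Summing the series amounts to
      \<open>1 + q / (1 - q) = 1 / (1 - q)\<close>.\<close>
    also have "\<dots> = K * D powr (1 - d) / (1 - q)" using q by (simp add: field_simps)
    finally show ?case .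
  qed
  obtain n where "(2/3 :: real) ^ n < 1 / \<Delta>"
    using real_arch_pow_inv[of "1 / \<Delta>" "2/3"] \<open>\<Delta> > 0\<close> by auto
  then have "(2/3) ^ n * \<Delta> < 1" using \<open>\<Delta> > 0\<close> by (simp add: field_simps)
  then show ?thesis using claim[of B \<Delta> n] assms by (simp add: K_def q_def)
qed

section \<open>Transfer to graphs\<close>

text \<open>Any enumeration \<open>h\<close> of the heads by \<open>{1..card S}\<close> works, with
  \<open>T (h i)\<close> as the tooth at index \<open>i\<close>; heads and teeth are kept apart by
  the bipartition.\<close>

lemma comb_in_if_set_comb:
  assumes "bipartition G A B" "finite S" "S \<subseteq> A" "\<And>s. s \<in> S \<Longrightarrow> T s \<subseteq> B"
    and comb: "set_comb (\<lambda>a. neighbours_in G a B) k S T"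
  shows "\<exists>a C. comb_in G A B (card S) k a C"
proof -
  obtain h where h: "bij_betw h {1..card S} S"
    using ex_bij_betw_nat_finite_1[OF \<open>finite S\<close>] by blast
  have im: "h ` {1..card S} = S" and inj: "inj_on h {1..card S}"
    using h by (auto simp: bij_betw_def)
  have hS: "h i \<in> S" if "i \<in> {1..card S}" for i using im that by blast
  have neq: "h i \<noteq> h j" if "i \<in> {1..card S}" "j \<in> {1..card S}" "i \<noteq> j" for i j
    using inj that by (auto dest: inj_onD)
  have AB: "A \<union> B = verts G" "A \<inter> B = {}" using assms(1) by (auto simp: bipartition_def)
  have T: "T s \<subseteq> neighbours_in G s B" "k \<le> real (card (T s))" if "s \<in> S" for s
    using comb that by (auto simp: set_comb_def)
  have disj: "T s \<inter> T s' = {}" "neighbours_in G s B \<inter> T s' = {}"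
    if "s \<in> S" "s' \<in> S" "s \<noteq> s'" for s s'
    using comb that by (simp_all add: set_comb_def disjoint_family_on_def)
  have "comb G (card S) k h (\<lambda>i. T (h i))"
    unfolding comb_def im
  proof (intro conjI ballI impI)
    show "S \<subseteq> verts G" using assms(3) AB by auto
    show "inj_on h {1..card S}" by (fact inj)
    show "disjoint_family_on (\<lambda>i. T (h i)) {1..card S}"
      unfolding disjoint_family_on_def by (intro ballI impI disj hS neq)
  next
    fix i assume i: "i \<in> {1..card S}"
    show "T (h i) \<subseteq> verts G - S" using assms(3) assms(4)[OF hS[OF i]] AB by auto
    show "k \<le> real (card (T (h i)))" by (intro T hS i)
    show "h i \<rightarrow>\<^bsub>G\<^esub> v" if "v \<in> T (h i)" for v
      using T(1)[OF hS[OF i]] that by (auto simp: neighbours_in_def)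
    fix j assume j: "j \<in> {1..card S}" "i \<noteq> j"
    show "neighbours_in G (h i) (T (h j)) = {}"
      using disj(2)[OF hS[OF i] hS[OF j(1)] neq[OF i j]] assms(4)[OF hS[OF j(1)]]
      by (auto simp: neighbours_in_def)
  qed
  moreover have "\<forall>i\<in>{1..card S}. T (h i) \<subseteq> B" by (intro ballI assms(4) hS)
  ultimately have "comb_in G A B (card S) k h (\<lambda>i. T (h i))"
    unfolding comb_in_def im using assms(3) AB by auto
  then show ?thesis by blast
qed

theorem mainTheorem7:
  fixes G :: "('v, 'e) pre_digraph" and A B :: "'v set" and \<Gamma> \<Delta> d :: real
  assumes "graph G"
    and "bipartition G A B"
    and "\<And>v. v \<in> B \<Longrightarrow> neighbours_in G v A \<noteq> {}"
    and "\<Gamma> > 0" and "\<Delta> > 0" and "d > 0" and "d < 1"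
    and "\<And>v. v \<in> A \<Longrightarrow> real (card (neighbours_in G v B)) \<le> \<Delta>"
  shows "(\<exists>t::nat. t \<ge> 1 \<and>
            (\<exists>a C. comb_in G A B t (\<Gamma> * real t powr (- 1 / d)) a C)) \<or>
         real (card B) \<le> 3 powr (d + 1) / (3 / 2 - (3 / 2) powr d) * \<Gamma> powr d * \<Delta> powr (1 - d)"
proof (rule disjCI)
  assume no: "\<not> real (card B)
    \<le> 3 powr (d + 1) / (3 / 2 - (3 / 2) powr d) * \<Gamma> powr d * \<Delta> powr (1 - d)"
  interpret graph G by fact
  let ?N = "\<lambda>a. neighbours_in G a B"
  have "finite B"
    using assms(2) finite_verts by (auto simp: bipartition_def intro: finite_subset)
  have deg: "real (card (?N a \<inter> B)) \<le> \<Delta>" if "a \<in> A" for a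
  proof -
    have "?N a \<inter> B = ?N a" by (auto simp: neighbours_in_def)
    then show ?thesis using assms(8)[OF that] by simp
  qed
  \<comment> \<open>The hypothesis provides arcs from \<open>B\<close> to \<open>A\<close>; symmetry
    of the arcs reverses them.\<close>
  have cover: "B \<subseteq> (\<Union>a\<in>A. ?N a)"
  proof
    fix b assume "b \<in> B"
    then obtain a where "a \<in> A" "b \<rightarrow>\<^bsub>G\<^esub> a"
      using assms(3)[of b] by (auto simp: neighbours_in_def)
    then show "b \<in> (\<Union>a\<in>A. ?N a)"
      using \<open>b \<in> B\<close> sym_arcs by (auto simp: neighbours_in_def symmetric_def dest: symD)
  qed
  \<comment> \<open>Since \<open>(2/3) powr (1 - d) = 2/3 * (3/2) powr d\<close>, a factor 2/3 comes
    out of the denominator and turns \<open>2 * 3 powr d\<close> into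
    \<open>3 powr (d + 1)\<close>.\<close>
  have const: "2 * (3 * \<Gamma>) powr d * \<Delta> powr (1 - d) / (1 - (2/3) powr (1 - d))
      = 3 powr (d + 1) / (3 / 2 - (3 / 2) powr d) * \<Gamma> powr d * \<Delta> powr (1 - d)"
  proof -
    have "(2/3 :: real) powr (1 - d) = 2 / 3 * (3 / 2) powr d"
      by (simp add: powr_diff powr_divide)
    then have "1 - (2/3 :: real) powr (1 - d) = 2 / 3 * (3 / 2 - (3 / 2) powr d)" by simp
    moreover have "x / (2 / 3 * y) = 3 / 2 * x / y" for x y :: real by simp
    ultimately show ?thesis by (simp only: powr_mult powr_add) simp
  qed
  have "\<exists>S T. finite S \<and> S \<noteq> {} \<and> S \<subseteq> A \<and> (\<forall>s\<in>S. T s \<subseteq> B) \<and>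
      set_comb ?N (\<Gamma> * real (card S) powr (- 1 / d)) S T"
  proof (rule ccontr)
    assume "\<not> ?thesis"
    from card_le_geometric_if_no_comb[where N = ?N, OF assms(4,6,7) \<open>finite B\<close> assms(5) deg cover this]
    show False using no unfolding const by contradiction
  qed
  then obtain S T where S: "finite S" "S \<noteq> {}" "S \<subseteq> A" "\<forall>s\<in>S. T s \<subseteq> B"
    and "set_comb ?N (\<Gamma> * real (card S) powr (- 1 / d)) S T"
    by blast
  moreover have "card S \<ge> 1" using S(1,2) by (simp add: Suc_le_eq card_gt_0_iff)
  ultimately show "\<exists>t::nat. t \<ge> 1 \<and>
      (\<exists>a C. comb_in G A B t (\<Gamma> * real t powr (- 1 / d)) a C)"
    using comb_in_if_set_comb[OF assms(2) S(1,3)] S(4) by blast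
qed

end
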